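(* For every integer $n \geq 1$, the variety $\mathbf{MS4}[n]$ has the finite model property: for every formula $\varphi$ in the language with modalities $\lozenge,\exists$, if $\mathbf{MS4}[n] \not\models \varphi$ then there is a finite $\mathsf{MS4}[n]$-algebra $\mathfrak{A}$ with $\mathfrak{A} \not\models \varphi$.
   Context: An $\mathsf{MS4}$-algebra is a tuple $(B,\lozenge,\exists)$ where $B$ is a Boolean algebra, $\lozenge$ is a closure operator on $B$ ($\lozenge 0=0$, $\lozenge(a\vee b)=\lozenge a\vee\lozenge b$, $a\le\lozenge a$, $\lozenge\lozenge a\le\lozenge a$), $\exists$ is an $\mathsf{S5}$-operator (a closure operator additionally satisfying $\exists\forall a\le\forall a$, where $\forall = \neg\exists\neg$), and $\exists\lozenge a\le\lozenge\exists a$ for all $a$. Write $\square=\neg\lozenge\neg$. Define formulas $P_1 = \lozenge\square q_1\to\square q_1$ and $P_n = \lozenge(\square q_n\wedge\neg P_{n-1})\to\square q_n$. $\mathbf{MS4}[n]$ is the variety of $\mathsf{MS4}$-algebras satisfying $P_n \approx 1$ (an $\mathsf{MS4}[n]$-algebra is a member of it). $\mathfrak{A}\models\varphi$ means $\varphi\approx 1$ holds in $\mathfrak{A}$. *)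

theory Defs
  imports "HOL-Algebra.Lattice"
begin

section \<open>MS4-algebras\<close>

text \<open>
  Algebras have explicit carriers, so that a finite algebra can be asserted to exist inside a
  theorem. Meet, join, top and bottom are those of the underlying bounded lattice. The component
  \<open>eq\<close> inherited from HOL-Algebra is equality in every bounded lattice.
\<close>

record 'a bool_alg = "'a gorder" +
  neg :: "'a \<Rightarrow> 'a" (\<open>\<^bold>\<not>\<index> _\<close> [80] 80)

locale bool_algebra = bounded_lattice B for B :: "('a, 'm) bool_alg_scheme" (structure) +
  assumes meet_join_distrib:
      "\<lbrakk>x \<in> carrier B; y \<in> carrier B; z \<in> carrier B\<rbrakk>
        \<Longrightarrow> x \<sqinter> (y \<squnion> z) = (x \<sqinter> y) \<squnion> (x \<sqinter> z)"
    and neg_closed: "x \<in> carrier B \<Longrightarrow> \<^bold>\<not> x \<in> carrier B"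
    and meet_neg: "x \<in> carrier B \<Longrightarrow> x \<sqinter> \<^bold>\<not> x = \<bottom>"
    and join_neg: "x \<in> carrier B \<Longrightarrow> x \<squnion> \<^bold>\<not> x = \<top>"

definition closure_operator :: "('a, 'm) bool_alg_scheme \<Rightarrow> ('a \<Rightarrow> 'a) \<Rightarrow> bool" where
  "closure_operator B f \<longleftrightarrow>
     f \<in> carrier B \<rightarrow> carrier B \<and>
     f \<bottom>\<^bsub>B\<^esub> = \<bottom>\<^bsub>B\<^esub> \<and>
     (\<forall>a \<in> carrier B. \<forall>b \<in> carrier B. f (a \<squnion>\<^bsub>B\<^esub> b) = f a \<squnion>\<^bsub>B\<^esub> f b) \<and>
     (\<forall>a \<in> carrier B. a \<sqsubseteq>\<^bsub>B\<^esub> f a) \<and>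
     (\<forall>a \<in> carrier B. f (f a) \<sqsubseteq>\<^bsub>B\<^esub> f a)"

definition dual_operator :: "('a, 'm) bool_alg_scheme \<Rightarrow> ('a \<Rightarrow> 'a) \<Rightarrow> 'a \<Rightarrow> 'a" where
  "dual_operator B f a = \<^bold>\<not>\<^bsub>B\<^esub> f (\<^bold>\<not>\<^bsub>B\<^esub> a)"

definition S5_operator :: "('a, 'm) bool_alg_scheme \<Rightarrow> ('a \<Rightarrow> 'a) \<Rightarrow> bool" where
  "S5_operator B f \<longleftrightarrow>
     closure_operator B f \<and>
     (\<forall>a \<in> carrier B. f (dual_operator B f a) \<sqsubseteq>\<^bsub>B\<^esub> dual_operator B f a)"

record 'a ms4 = "'a bool_alg" +
  dia :: "'a \<Rightarrow> 'a" (\<open>\<diamond>\<index> _\<close> [80] 80)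
  ex :: "'a \<Rightarrow> 'a" (\<open>\<^bold>\<exists>\<index> _\<close> [80] 80)

locale ms4_algebra = bool_algebra A for A :: "('a, 'm) ms4_scheme" (structure) +
  assumes closure_dia: "closure_operator A (dia A)"
    and S5_ex: "S5_operator A (ex A)"
    and ex_dia_le: "a \<in> carrier A \<Longrightarrow> \<^bold>\<exists> \<diamond> a \<sqsubseteq> \<diamond> \<^bold>\<exists> a"


section \<open>Formulas and validity\<close>

text \<open>The propositional letter \<open>q\<^sub>n\<close> is \<open>Var n\<close>.\<close>

datatype fm = Var nat | Bot | Neg fm | Conj fm fm | Disj fm fm | Dia fm | Ex fm

definition Imp :: "fm \<Rightarrow> fm \<Rightarrow> fm" where
  "Imp \<phi> \<psi> = Disj (Neg \<phi>) \<psi>"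

definition Box :: "fm \<Rightarrow> fm" where
  "Box \<phi> = Neg (Dia (Neg \<phi>))"

primrec val :: "('a, 'm) ms4_scheme \<Rightarrow> (nat \<Rightarrow> 'a) \<Rightarrow> fm \<Rightarrow> 'a" where
  "val A v (Var i) = v i"
| "val A v Bot = \<bottom>\<^bsub>A\<^esub>"
| "val A v (Neg \<phi>) = \<^bold>\<not>\<^bsub>A\<^esub> val A v \<phi>"
| "val A v (Conj \<phi> \<psi>) = val A v \<phi> \<sqinter>\<^bsub>A\<^esub> val A v \<psi>"
| "val A v (Disj \<phi> \<psi>) = val A v \<phi> \<squnion>\<^bsub>A\<^esub> val A v \<psi>"
| "val A v (Dia \<phi>) = \<diamond>\<^bsub>A\<^esub> val A v \<phi>"
| "val A v (Ex \<phi>) = \<^bold>\<exists>\<^bsub>A\<^esub> val A v \<phi>"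

definition valid :: "('a, 'm) ms4_scheme \<Rightarrow> fm \<Rightarrow> bool" where
  "valid A \<phi> \<longleftrightarrow> (\<forall>v \<in> UNIV \<rightarrow> carrier A. val A v \<phi> = \<top>\<^bsub>A\<^esub>)"

definition class_valid :: "'a ms4 set \<Rightarrow> fm \<Rightarrow> bool" where
  "class_valid K \<phi> \<longleftrightarrow> (\<forall>A \<in> K. valid A \<phi>)"


section \<open>The varieties MS4[n]\<close>

text \<open>The value at \<open>0\<close> is a dummy; the family starts at \<open>1\<close>.\<close>

fun P :: "nat \<Rightarrow> fm" where
  "P 0 = Bot"
| "P (Suc 0) = Imp (Dia (Box (Var 1))) (Box (Var 1))"
| "P (Suc (Suc n)) =
     Imp (Dia (Conj (Box (Var (Suc (Suc n)))) (Neg (P (Suc n))))) (Box (Var (Suc (Suc n))))"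

text \<open>
  \<open>MS4 n\<close> consists of the members of MS4[n] whose elements are taken from the type \<open>'a\<close>; the whole
  variety is obtained by letting \<open>'a\<close> vary.
\<close>

definition MS4 :: "nat \<Rightarrow> 'a ms4 set" where
  "MS4 n = {A. ms4_algebra A \<and> valid A (P n)}"

end

theory Submission
  imports Defs
begin

text \<open>
  Represent an algebra refuting \<open>\<phi>\<close> as a field of sets of ultrafilters, with \<open>\<diamond>\<close> given by a
  quasi-order \<open>R\<close>. Validity of \<open>P\<^sub>n\<close> bounds the depth of \<open>R\<close> by \<open>n\<close>, so by the Segerberg-Maksimova
  argument any finite set of elements, here the values of the subformulas of \<open>\<phi>\<close>, lies in a finite
  Boolean subalgebra \<open>S\<close> closed under \<open>\<diamond>\<close>. It need not be closed under \<open>\<exists>\<close>; replace \<open>\<exists>\<close> on \<open>S\<close> by the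
  operator \<open>\<exists>'\<close> sending \<open>a\<close> to the least \<open>\<exists>\<close>-fixed element of \<open>S\<close> above \<open>a\<close>. This is an S5-operator,
  it agrees with \<open>\<exists>\<close> wherever \<open>\<exists>a \<in> S\<close>, and \<open>\<exists>'\<diamond>a \<le> \<diamond>\<exists>'a\<close> because \<open>\<diamond>\<exists>'a\<close> is itself \<open>\<exists>\<close>-fixed. Since
  \<open>P\<^sub>n\<close> does not mention \<open>\<exists>\<close>, the finite algebra still validates it.
\<close>

section \<open>Algebras of sets\<close>

definition set_closure :: "'x set set \<Rightarrow> ('x set \<Rightarrow> 'x set) \<Rightarrow> bool" where
  "set_closure F f \<longleftrightarrow>
     f \<in> F \<rightarrow> F \<and> f {} = {} \<and> (\<forall>U\<in>F. \<forall>V\<in>F. f (U \<union> V) = f U \<union> f V) \<and>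
     (\<forall>U\<in>F. U \<subseteq> f U) \<and> (\<forall>U\<in>F. f (f U) \<subseteq> f U)"

locale field_of_sets =
  fixes X :: "'x set" and F :: "'x set set"
  assumes subset_X: "U \<in> F \<Longrightarrow> U \<subseteq> X"
    and empty_closed: "{} \<in> F"
    and Un_closed: "U \<in> F \<Longrightarrow> V \<in> F \<Longrightarrow> U \<union> V \<in> F"
    and compl_closed: "U \<in> F \<Longrightarrow> X - U \<in> F"
begin

lemma space_closed: "X \<in> F"
  using compl_closed [OF empty_closed] by simp

lemma Int_closed:
  assumes "U \<in> F" "V \<in> F"
  shows "U \<inter> V \<in> F"
proof -
  have "U \<inter> V = X - ((X - U) \<union> (X - V))"
    using assms [THEN subset_X] by blast
  then show ?thesis
    using assms by (simp add: Un_closed compl_closed)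
qed

lemma set_closure_mono:
  assumes "set_closure F f" "U \<in> F" "V \<in> F" "U \<subseteq> V"
  shows "f U \<subseteq> f V"
proof -
  have "f V = f U \<union> f V"
    using assms unfolding set_closure_def by (metis subset_Un_eq)
  then show ?thesis by blast
qed

end

text \<open>\<open>E_compl\<close> is the S5 axiom with its argument replaced by the complement;
  \<open>F\<close> is closed under complements, so the two forms agree.\<close>

locale ms4_field = field_of_sets X F
  for X :: "'x set" and F +
  fixes D E :: "'x set \<Rightarrow> 'x set"
  assumes closure_D: "set_closure F D"
    and closure_E: "set_closure F E"
    and E_compl: "U \<in> F \<Longrightarrow> E (X - E U) \<subseteq> X - E U"
    and E_D: "U \<in> F \<Longrightarrow> E (D U) \<subseteq> D (E U)"

primrec sval :: "'x set \<Rightarrow> ('x set \<Rightarrow> 'x set) \<Rightarrow> ('x set \<Rightarrow> 'x set) \<Rightarrow> (nat \<Rightarrow> 'x set) \<Rightarrow> fm \<Rightarrow> 'x set"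
  where
  "sval X D E v (Var i) = v i"
| "sval X D E v Bot = {}"
| "sval X D E v (Neg \<phi>) = X - sval X D E v \<phi>"
| "sval X D E v (Conj \<phi> \<psi>) = sval X D E v \<phi> \<inter> sval X D E v \<psi>"
| "sval X D E v (Disj \<phi> \<psi>) = sval X D E v \<phi> \<union> sval X D E v \<psi>"
| "sval X D E v (Dia \<phi>) = D (sval X D E v \<phi>)"
| "sval X D E v (Ex \<phi>) = E (sval X D E v \<phi>)"

lemma (in field_of_sets) sval_closed:
  assumes "D \<in> F \<rightarrow> F" "E \<in> F \<rightarrow> F" "\<And>i. v i \<in> F"
  shows "sval X D E v \<phi> \<in> F"
  by (induction \<phi>)
    (use assms in \<open>auto simp: empty_closed Un_closed Int_closed compl_closed\<close>)


section \<open>Representation of algebras by fields of sets\<close>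

text \<open>No lattice or modal axiom is assumed of \<open>A\<close>: the lattice structure is
  recovered through \<open>h\<close>, and the laws of \<open>D\<close> and \<open>E\<close> stay
  open. The locale thus serves both the given algebra and the finite one to be built.\<close>

locale set_representation = field_of_sets X F
  for A :: "('a, 'm) ms4_scheme" (structure) and X :: "'x set" and F and D E
    and h :: "'a \<Rightarrow> 'x set" +
  assumes bij_h: "bij_betw h (carrier A) F"
    and eq_A: "(.=) = (=)"
    and le_iff: "a \<in> carrier A \<Longrightarrow> b \<in> carrier A \<Longrightarrow> a \<sqsubseteq> b \<longleftrightarrow> h a \<subseteq> h b"
    and neg_closed: "a \<in> carrier A \<Longrightarrow> \<^bold>\<not> a \<in> carrier A"
    and dia_closed: "a \<in> carrier A \<Longrightarrow> \<diamond> a \<in> carrier A"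
    and ex_closed: "a \<in> carrier A \<Longrightarrow> \<^bold>\<exists> a \<in> carrier A"
    and h_neg: "a \<in> carrier A \<Longrightarrow> h (\<^bold>\<not> a) = X - h a"
    and h_dia: "a \<in> carrier A \<Longrightarrow> h (\<diamond> a) = D (h a)"
    and h_ex: "a \<in> carrier A \<Longrightarrow> h (\<^bold>\<exists> a) = E (h a)"
begin

lemma h_closed: "a \<in> carrier A \<Longrightarrow> h a \<in> F"
  using bij_h by (auto simp: bij_betw_def)

lemma h_surj:
  assumes "U \<in> F"
  obtains a where "a \<in> carrier A" "h a = U"
  using assms bij_h by (auto simp: bij_betw_def)

lemma h_eq_iff: "a \<in> carrier A \<Longrightarrow> b \<in> carrier A \<Longrightarrow> h a = h b \<longleftrightarrow> a = b"
  using bij_h by (auto simp: bij_betw_def inj_on_def)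

lemma partial_order: "partial_order A"
  by unfold_locales (auto simp: eq_A le_iff simp flip: h_eq_iff)

interpretation partial_order A by (rule partial_order)

text \<open>Joins and meets in HOL-Algebra are chosen among least upper and greatest lower bounds.
  They are computed by exhibiting one such bound; uniqueness does the rest.\<close>

lemma least_Upper_of_Un:
  assumes "a \<in> carrier A" "b \<in> carrier A" "s \<in> carrier A" "h s = h a \<union> h b"
  shows "least A s (Upper A {a, b})"
  by (rule least_UpperI) (use assms in \<open>auto simp: le_iff Upper_def subset_iff\<close>)

lemma greatest_Lower_of_Int:
  assumes "a \<in> carrier A" "b \<in> carrier A" "s \<in> carrier A" "h s = h a \<inter> h b"
  shows "greatest A s (Lower A {a, b})"
  by (rule greatest_LowerI) (use assms in \<open>auto simp: le_iff Lower_def subset_iff\<close>)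

lemma least_of_empty:
  assumes "s \<in> carrier A" "h s = {}"
  shows "least A s (carrier A)"
  using assms by (auto simp: least_def le_iff)

lemma greatest_of_space:
  assumes "s \<in> carrier A" "h s = X"
  shows "greatest A s (carrier A)"
  using assms h_closed subset_X by (auto simp: greatest_def le_iff)

lemma bounded_lattice: "bounded_lattice A"
proof unfold_locales
  fix a b assume ab: "a \<in> carrier A" "b \<in> carrier A"
  show "\<exists>s. least A s (Upper A {a, b})"
    using least_Upper_of_Un [OF ab] h_surj [OF Un_closed] ab h_closed by metis
  show "\<exists>s. greatest A s (Lower A {a, b})"
    using greatest_Lower_of_Int [OF ab] h_surj [OF Int_closed] ab h_closed by metis
next
  show "\<exists>s. least A s (carrier A)"
    using least_of_empty h_surj [OF empty_closed] by metis
  show "\<exists>s. greatest A s (carrier A)"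
    using greatest_of_space h_surj [OF space_closed] by metis
qed

interpretation bounded_lattice A by (rule bounded_lattice)

lemma h_join:
  assumes ab: "a \<in> carrier A" "b \<in> carrier A"
  shows "h (a \<squnion> b) = h a \<union> h b"
proof -
  obtain s where s: "s \<in> carrier A" "h s = h a \<union> h b"
    using h_surj [OF Un_closed] ab h_closed by metis
  have "a \<squnion> b = s"
    unfolding join_def
    using least_unique [OF sup_of_two_least [OF ab] least_Upper_of_Un [OF ab s]] .
  with s show ?thesis by simp
qed

lemma h_meet:
  assumes ab: "a \<in> carrier A" "b \<in> carrier A"
  shows "h (a \<sqinter> b) = h a \<inter> h b"
proof -
  obtain s where s: "s \<in> carrier A" "h s = h a \<inter> h b"
    using h_surj [OF Int_closed] ab h_closed by metis
  have "a \<sqinter> b = s"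
    unfolding meet_def
    using greatest_unique [OF inf_of_two_greatest [OF ab] greatest_Lower_of_Int [OF ab s]] .
  with s show ?thesis by simp
qed

lemma h_bottom: "h \<bottom> = {}"
  using least_unique [OF bottom_least least_of_empty] h_surj [OF empty_closed] by metis

lemma h_top: "h \<top> = X"
  using greatest_unique [OF top_greatest greatest_of_space] h_surj [OF space_closed] by metis

lemma bool_algebra: "bool_algebra A"
proof unfold_locales
  fix a assume a: "a \<in> carrier A"
  then have "h a \<subseteq> X" by (simp add: h_closed subset_X)
  then show "a \<sqinter> \<^bold>\<not> a = \<bottom>" "a \<squnion> \<^bold>\<not> a = \<top>"
    using a by (auto simp: neg_closed h_meet h_join h_neg h_bottom h_top simp flip: h_eq_iff)
qed (auto simp: neg_closed h_meet h_join simp flip: h_eq_iff)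

lemma closure_operator_iff:
  assumes closed: "\<And>a. a \<in> carrier A \<Longrightarrow> f a \<in> carrier A"
    and h_f: "\<And>a. a \<in> carrier A \<Longrightarrow> h (f a) = f' (h a)"
  shows "closure_operator A f \<longleftrightarrow> set_closure F f'"
proof -
  have F: "F = h ` carrier A"
    using bij_h by (simp add: bij_betw_def)
  have "f' \<in> F \<rightarrow> F"
    using closed h_f unfolding F by (auto simp flip: h_f)
  then show ?thesis
    unfolding closure_operator_def set_closure_def F
    by (simp add: closed h_f le_iff h_join h_bottom flip: h_eq_iff)
qed

text \<open>Needed in both directions: from the given algebra to sets of ultrafilters, and from a
  finite field of sets back to an algebra.\<close>

lemma ms4_algebra_iff: "ms4_algebra A \<longleftrightarrow> ms4_field X F D E"
proof -
  interpret bool_algebra A by (rule bool_algebra)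
  have F: "F = h ` carrier A"
    using bij_h by (simp add: bij_betw_def)
  have S5: "(\<forall>a\<in>carrier A. \<^bold>\<exists> (dual_operator A (ex A) a) \<sqsubseteq> dual_operator A (ex A) a) \<longleftrightarrow>
      (\<forall>U\<in>F. E (X - E U) \<subseteq> X - E U)" (is "?l \<longleftrightarrow> ?r")
  proof -
    have "?l \<longleftrightarrow> (\<forall>a\<in>carrier A. E (X - E (X - h a)) \<subseteq> X - E (X - h a))"
      by (simp add: dual_operator_def neg_closed ex_closed le_iff h_neg h_ex)
    also have "\<dots> \<longleftrightarrow> (\<forall>U\<in>F. E (X - E (X - U)) \<subseteq> X - E (X - U))"
      by (simp add: F)
    also have "\<dots> \<longleftrightarrow> ?r"
      using compl_closed subset_X by (metis double_diff order_refl)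
    finally show ?thesis .
  qed
  have comm: "(\<forall>a\<in>carrier A. \<^bold>\<exists> \<diamond> a \<sqsubseteq> \<diamond> \<^bold>\<exists> a) \<longleftrightarrow> (\<forall>U\<in>F. E (D U) \<subseteq> D (E U))"
    by (simp add: F dia_closed ex_closed le_iff h_dia h_ex)
  show ?thesis
    unfolding ms4_algebra_def ms4_field_def ms4_algebra_axioms_def ms4_field_axioms_def
      S5_operator_def
    using bool_algebra_axioms field_of_sets_axioms S5 comm
      closure_operator_iff [of "dia A" D] closure_operator_iff [of "ex A" E]
      dia_closed h_dia ex_closed h_ex
    by blast
qed

lemma val_closed_h_val:
  assumes "v \<in> UNIV \<rightarrow> carrier A"
  shows "val A v \<phi> \<in> carrier A \<and> h (val A v \<phi>) = sval X D E (h \<circ> v) \<phi>"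
proof (induction \<phi>)
  case Bot
  show ?case using h_bottom by simp
qed (use assms in \<open>auto simp: neg_closed dia_closed ex_closed h_neg h_dia h_ex h_join h_meet\<close>)

text \<open>Since \<open>h\<close> maps onto \<open>F\<close>, every valuation by sets lifts to one
  by elements, so both sides range over the same valuations.\<close>

lemma valid_iff: "valid A \<phi> \<longleftrightarrow> (\<forall>v\<in>UNIV \<rightarrow> F. sval X D E v \<phi> = X)"
proof -
  have "val A v \<phi> = \<top> \<longleftrightarrow> sval X D E (h \<circ> v) \<phi> = X" if "v \<in> UNIV \<rightarrow> carrier A" for v
    using val_closed_h_val [OF that, of \<phi>] h_eq_iff [of "val A v \<phi>" "\<top>"] h_top by auto
  moreover have "\<exists>v\<in>UNIV \<rightarrow> carrier A. w = h \<circ> v" if "w \<in> UNIV \<rightarrow> F" for w :: "nat \<Rightarrow> _"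
  proof -
    have "\<forall>i. \<exists>a\<in>carrier A. h a = w i"
      using that h_surj by (metis Pi_iff UNIV_I)
    then obtain v where "\<forall>i. v i \<in> carrier A \<and> h (v i) = w i" by metis
    then show ?thesis by (intro bexI [of _ v]) auto
  qed
  moreover have "h \<circ> v \<in> UNIV \<rightarrow> F" if "v \<in> UNIV \<rightarrow> carrier A" for v :: "nat \<Rightarrow> _"
    using that by (auto simp: Pi_iff intro: h_closed)
  ultimately show ?thesis
    unfolding valid_def by metis
qed

end

section \<open>Ultrafilters\<close>

context bool_algebra
begin

text \<open>Complementation and primeness suffice: upward closure follows because
  \<open>a \<sqsubseteq> b\<close> means \<open>a \<squnion> b = b\<close>, and then
  \<open>\<bottom>\<close> is excluded because its complement would belong as well.\<close>

definition ultrafilter :: "'a set \<Rightarrow> bool" where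
  "ultrafilter z \<longleftrightarrow> z \<subseteq> carrier B \<and>
     (\<forall>a\<in>carrier B. \<^bold>\<not> a \<in> z \<longleftrightarrow> a \<notin> z) \<and>
     (\<forall>a\<in>carrier B. \<forall>b\<in>carrier B. a \<squnion> b \<in> z \<longleftrightarrow> a \<in> z \<or> b \<in> z)"

definition order_ideal :: "'a set \<Rightarrow> bool" where
  "order_ideal J \<longleftrightarrow> J \<subseteq> carrier B \<and> \<bottom> \<in> J \<and>
     (\<forall>a\<in>J. \<forall>b\<in>J. a \<squnion> b \<in> J) \<and>
     (\<forall>a\<in>carrier B. \<forall>b\<in>J. a \<sqsubseteq> b \<longrightarrow> a \<in> J)"

lemma ultrafilter_upward:
  assumes "ultrafilter z" "a \<in> z" "b \<in> carrier B" "a \<sqsubseteq> b"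
  shows "b \<in> z"
proof -
  have "a \<in> carrier B" using assms by (auto simp: ultrafilter_def)
  then have "a \<squnion> b = b" using assms le_iff_meet by blast
  with assms \<open>a \<in> carrier B\<close> show ?thesis by (metis ultrafilter_def)
qed

text \<open>Case distinction on \<open>c\<close>: the second bound gives
  \<open>a \<sqinter> c \<sqsubseteq> j\<close>, and the first splits \<open>a\<close> into its
  meets with \<open>j\<close> and \<open>c\<close>.\<close>

lemma le_by_cases:
  assumes a: "a \<in> carrier B" and j: "j \<in> carrier B" and c: "c \<in> carrier B"
    and 1: "a \<sqsubseteq> j \<squnion> c" and 2: "a \<sqsubseteq> j \<squnion> \<^bold>\<not> c"
  shows "a \<sqsubseteq> j"
proof -
  note [simp] = a j c neg_closed
  have "a \<sqinter> c \<sqsubseteq> c \<sqinter> (j \<squnion> \<^bold>\<not> c)"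
    by (rule meet_le) (use 2 in \<open>auto intro: meet_right le_trans [OF meet_left]\<close>)
  also have "c \<sqinter> (j \<squnion> \<^bold>\<not> c) = (c \<sqinter> j) \<squnion> \<bottom>"
    by (simp add: meet_join_distrib meet_neg)
  also have "\<dots> \<sqsubseteq> j"
    by (rule join_le) (auto intro: meet_right)
  finally have "a \<sqinter> c \<sqsubseteq> j" by simp
  moreover have "a \<sqinter> j \<sqsubseteq> j" by (auto intro: meet_right)
  ultimately have "(a \<sqinter> j) \<squnion> (a \<sqinter> c) \<sqsubseteq> j" by (auto intro: join_le)
  moreover have "a \<sqsubseteq> a \<sqinter> (j \<squnion> c)"
    by (rule meet_le) (use 1 in auto)
  ultimately show ?thesis
    by (simp add: meet_join_distrib) (rule le_trans, auto)
qed

text \<open>Zorn's lemma yields an ideal \<open>M\<close> that is maximal among those containing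
  \<open>I\<close> and missing \<open>a\<close>; its complement is the ultrafilter.\<close>

lemma ultrafilter_avoiding_ideal:
  assumes I: "order_ideal I" and a: "a \<in> carrier B" "a \<notin> I"
  obtains z where "ultrafilter z" "a \<in> z" "z \<inter> I = {}"
proof -
  define \<J> where "\<J> = {J. order_ideal J \<and> I \<subseteq> J \<and> a \<notin> J}"
  have "\<exists>M\<in>\<J>. \<forall>J\<in>\<J>. M \<subseteq> J \<longrightarrow> J = M"
  proof (rule subset_Zorn_nonempty)
    show "\<J> \<noteq> {}" using I a by (auto simp: \<J>_def)
  next
    fix C assume C: "C \<noteq> {}" "subset.chain \<J> C"
    then have ideals: "\<And>J. J \<in> C \<Longrightarrow> order_ideal J \<and> I \<subseteq> J \<and> a \<notin> J"
      by (auto simp: \<J>_def subset.chain_def)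
    have join: "x \<squnion> y \<in> \<Union>C" if "x \<in> J" "J \<in> C" "y \<in> K" "K \<in> C" for x y J K
    proof -
      have "J \<subseteq> K \<or> K \<subseteq> J"
        using C that by (auto simp: subset_chain_def)
      then show ?thesis
        using that ideals [of J] ideals [of K] unfolding order_ideal_def by blast
    qed
    have sub: "\<Union>C \<subseteq> carrier B" "\<bottom> \<in> \<Union>C" "I \<subseteq> \<Union>C" "a \<notin> \<Union>C"
      using C ideals unfolding order_ideal_def by blast+
    have down: "x \<in> \<Union>C" if "x \<in> carrier B" "y \<in> \<Union>C" "x \<sqsubseteq> y" for x y
      using that ideals unfolding order_ideal_def by blast
    have "order_ideal (\<Union>C)"
      unfolding order_ideal_def
      using sub(1,2) join down by (intro conjI ballI impI) (assumption | elim UnionE)+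
    then show "\<Union>C \<in> \<J>"
      using sub by (simp add: \<J>_def)
  qed
  then obtain M where M: "order_ideal M" "I \<subseteq> M" "a \<notin> M"
    and max: "\<And>J. order_ideal J \<Longrightarrow> a \<notin> J \<Longrightarrow> M \<subseteq> J \<Longrightarrow> J = M"
    by (force simp: \<J>_def)
  have M_sub: "x \<in> M \<Longrightarrow> x \<in> carrier B" for x
    using M by (auto simp: order_ideal_def)
  have M_join: "x \<squnion> y \<in> M" if "x \<in> M" "y \<in> M" for x y
    using M that by (auto simp: order_ideal_def)
  have M_down: "x \<in> M" if "x \<sqsubseteq> y" "x \<in> carrier B" "y \<in> M" for x y
    using M that by (auto simp: order_ideal_def)
  have M_bot: "\<bottom> \<in> M"
    using M by (auto simp: order_ideal_def)
  \<comment> \<open>Otherwise the ideal \<open>K\<close> generated by \<open>M\<close> and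
    \<open>c\<close> would still miss \<open>a\<close>, against maximality.\<close>
  have extend: "\<exists>j\<in>M. a \<sqsubseteq> j \<squnion> c" if c: "c \<in> carrier B" "c \<notin> M" for c
  proof (rule ccontr)
    assume contra: "\<not> ?thesis"
    define K where "K = {x \<in> carrier B. \<exists>j\<in>M. x \<sqsubseteq> j \<squnion> c}"
    have "x \<squnion> y \<in> K" if xy: "x \<in> K" "y \<in> K" for x y
    proof -
      obtain j k where jk: "j \<in> M" "k \<in> M" "x \<sqsubseteq> j \<squnion> c" "y \<sqsubseteq> k \<squnion> c"
        and [simp]: "x \<in> carrier B" "y \<in> carrier B"
        using xy by (auto simp: K_def)
      note [simp] = jk(1,2) [THEN M_sub] c(1)
      have "j \<squnion> c \<sqsubseteq> (j \<squnion> k) \<squnion> c" "k \<squnion> c \<sqsubseteq> (j \<squnion> k) \<squnion> c"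
        by (auto intro!: join_le join_right
            intro: le_trans [OF join_left join_left] le_trans [OF join_right join_left])
      then have "x \<squnion> y \<sqsubseteq> (j \<squnion> k) \<squnion> c"
        using jk by (intro join_le) (auto intro: le_trans)
      then show ?thesis
        using M_join [OF jk(1,2)] by (auto simp: K_def)
    qed
    moreover have "x \<in> K" if "x \<in> carrier B" "y \<in> K" "x \<sqsubseteq> y" for x y
      using that c M_sub by (auto simp: K_def) (meson join_closed le_trans)
    moreover have "M \<subseteq> K"
      unfolding K_def using M_sub c join_left by blast
    moreover have "c \<in> K"
      using M_bot M_sub c by (auto simp: K_def intro!: bexI [of _ \<bottom>] join_right)
    moreover have "a \<notin> K"
      using contra by (auto simp: K_def)
    moreover have "K \<subseteq> carrier B"
      by (auto simp: K_def)
    ultimately have "K = M"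
      using M_bot by (intro max) (auto simp: order_ideal_def)
    with \<open>c \<in> K\<close> c show False by simp
  qed
  \<comment> \<open>If \<open>c\<close> and its complement were both outside \<open>M\<close>, then
    \<open>extend\<close> and the case distinction on \<open>c\<close> would put \<open>a\<close>
    below an element of \<open>M\<close>.\<close>
  have neg: "\<^bold>\<not> c \<in> M \<longleftrightarrow> c \<notin> M" if c: "c \<in> carrier B" for c
  proof (rule iffI; rule ccontr)
    assume "\<^bold>\<not> c \<in> M" "\<not> c \<notin> M"
    then have "\<top> \<in> M"
      using M_join join_neg [OF c] by metis
    then show False
      using M(3) M_down a by blast
  next
    assume *: "c \<notin> M" "\<^bold>\<not> c \<notin> M"
    obtain j k where jk: "j \<in> M" "k \<in> M" "a \<sqsubseteq> j \<squnion> c" "a \<sqsubseteq> k \<squnion> \<^bold>\<not> c"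
      using extend * c neg_closed by metis
    note [simp] = jk(1,2) [THEN M_sub] c a neg_closed
    have "j \<squnion> c \<sqsubseteq> (j \<squnion> k) \<squnion> c" "k \<squnion> \<^bold>\<not> c \<sqsubseteq> (j \<squnion> k) \<squnion> \<^bold>\<not> c"
      by (auto intro!: join_le join_right
          intro: le_trans [OF join_left join_left] le_trans [OF join_right join_left])
    then have "a \<sqsubseteq> j \<squnion> k"
      using jk by (intro le_by_cases [of a "j \<squnion> k" c]) (auto intro: le_trans)
    then show False
      using M(3) M_down M_join [OF jk(1,2)] a by blast
  qed
  have join: "b \<squnion> c \<in> M \<longleftrightarrow> b \<in> M \<and> c \<in> M" if "b \<in> carrier B" "c \<in> carrier B" for b c
    using that M_join M_down join_left join_right by (metis join_closed)
  have "ultrafilter (carrier B - M)"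
    unfolding ultrafilter_def by (auto simp: neg neg_closed join)
  then show ?thesis
    using that [of "carrier B - M"] a M by auto
qed

definition stone :: "'a \<Rightarrow> 'a set set" where
  "stone a = {z. ultrafilter z \<and> a \<in> z}"

lemma stone_neg: "a \<in> carrier B \<Longrightarrow> stone (\<^bold>\<not> a) = Collect ultrafilter - stone a"
  by (auto simp: stone_def ultrafilter_def)

lemma stone_join: "a \<in> carrier B \<Longrightarrow> b \<in> carrier B \<Longrightarrow> stone (a \<squnion> b) = stone a \<union> stone b"
  by (auto simp: stone_def ultrafilter_def)

lemma stone_top: "stone \<top> = Collect ultrafilter"
proof -
  have "\<top> = \<top> \<squnion> \<^bold>\<not> \<top>" by (simp add: join_neg)
  then show ?thesis
    using stone_neg [of \<top>] stone_join [of \<top> "\<^bold>\<not> \<top>"] neg_closed [of \<top>]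
    by (auto simp: stone_def)
qed

lemma stone_subset_iff:
  assumes "a \<in> carrier B" "b \<in> carrier B"
  shows "stone a \<subseteq> stone b \<longleftrightarrow> a \<sqsubseteq> b"
proof
  assume *: "stone a \<subseteq> stone b"
  show "a \<sqsubseteq> b"
  proof (rule ccontr)
    assume "\<not> a \<sqsubseteq> b"
    moreover have "order_ideal {c \<in> carrier B. c \<sqsubseteq> b}"
      using assms by (auto simp: order_ideal_def intro: join_le le_trans)
    ultimately obtain z where "ultrafilter z" "a \<in> z" "z \<inter> {c \<in> carrier B. c \<sqsubseteq> b} = {}"
      using ultrafilter_avoiding_ideal [of "{c \<in> carrier B. c \<sqsubseteq> b}" a] assms by auto
    then show False
      using * assms by (auto simp: stone_def)
  qed
qed (use assms in \<open>auto simp: stone_def intro: ultrafilter_upward\<close>)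

lemma stone_field: "field_of_sets (Collect ultrafilter) (stone ` carrier B)"
proof
  have "stone (\<^bold>\<not> \<top>) = {}"
    by (simp add: stone_neg stone_top)
  then show "{} \<in> stone ` carrier B"
    by (metis imageI neg_closed top_closed)
next
  fix U assume "U \<in> stone ` carrier B"
  then obtain a where a: "a \<in> carrier B" "U = stone a" by blast
  then show "Collect ultrafilter - U \<in> stone ` carrier B"
    by (auto simp flip: stone_neg intro: neg_closed)
  fix V assume "V \<in> stone ` carrier B"
  then obtain b where "b \<in> carrier B" "V = stone b" by blast
  with a show "U \<union> V \<in> stone ` carrier B"
    by (auto simp flip: stone_join)
qed (auto simp: stone_def)

end

section \<open>The Jonsson-Tarski representation\<close>

definition preimage :: "'x set \<Rightarrow> ('x \<Rightarrow> 'x \<Rightarrow> bool) \<Rightarrow> 'x set \<Rightarrow> 'x set" where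
  "preimage X R U = {x \<in> X. \<exists>y\<in>U. R x y}"

text \<open>A tight general frame in the sense of modal logic: the admissible sets determine
  \<open>R\<close>. Tightness yields transitivity and the sets that separate a point from those
  strictly below it.\<close>

locale ms4_general_frame = ms4_field X F "preimage X R" E
  for X :: "'x set" and F and R :: "'x \<Rightarrow> 'x \<Rightarrow> bool" and E +
  assumes tight: "x \<in> X \<Longrightarrow> y \<in> X \<Longrightarrow> (\<And>U. U \<in> F \<Longrightarrow> y \<in> U \<Longrightarrow> x \<in> preimage X R U) \<Longrightarrow> R x y"
begin

text \<open>By tightness this is the law that applying the closure operator twice gives nothing
  new.\<close>

lemma R_trans:
  assumes "x \<in> X" "y \<in> X" "z \<in> X" "R x y" "R y z"
  shows "R x z"
proof (rule tight)
  fix U assume "U \<in> F" "z \<in> U"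
  moreover from this have "x \<in> preimage X R (preimage X R U)"
    using assms by (auto simp: preimage_def)
  ultimately show "x \<in> preimage X R U"
    using closure_D by (auto simp: set_closure_def)
qed (use assms in auto)

end

context ms4_algebra
begin

definition canonical_rel :: "'a set \<Rightarrow> 'a set \<Rightarrow> bool" where
  "canonical_rel x y \<longleftrightarrow> (\<forall>a\<in>y. \<diamond> a \<in> x)"

lemma dia_closed: "a \<in> carrier A \<Longrightarrow> \<diamond> a \<in> carrier A"
  using closure_dia by (auto simp: closure_operator_def)

lemma ex_closed: "a \<in> carrier A \<Longrightarrow> \<^bold>\<exists> a \<in> carrier A"
  using S5_ex by (auto simp: S5_operator_def closure_operator_def)

lemma dia_join: "a \<in> carrier A \<Longrightarrow> b \<in> carrier A \<Longrightarrow> \<diamond> (a \<squnion> b) = \<diamond> a \<squnion> \<diamond> b"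
  using closure_dia by (auto simp: closure_operator_def)

lemma bottom_notin_ultrafilter:
  assumes "ultrafilter x"
  shows "\<bottom> \<notin> x"
proof
  assume "\<bottom> \<in> x"
  then have "\<^bold>\<not> \<bottom> \<in> x"
    using assms ultrafilter_upward [of x \<bottom> "\<^bold>\<not> \<bottom>"] neg_closed [of \<bottom>] by simp
  with \<open>\<bottom> \<in> x\<close> show False
    using assms by (auto simp: ultrafilter_def)
qed

text \<open>For an ultrafilter \<open>x\<close> the elements \<open>b\<close> with
  \<open>\<diamond> b\<close> outside \<open>x\<close> form an ideal. An ultrafilter avoiding it is
  a canonical successor of \<open>x\<close>, and one containing \<open>a\<close> exists if
  \<open>\<diamond> a\<close> is in \<open>x\<close>.\<close>

lemma stone_dia:
  assumes a: "a \<in> carrier A"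
  shows "stone (\<diamond> a) = preimage (Collect ultrafilter) canonical_rel (stone a)"
proof
  show "stone (\<diamond> a) \<subseteq> preimage (Collect ultrafilter) canonical_rel (stone a)"
  proof
    fix x assume "x \<in> stone (\<diamond> a)"
    then have x: "ultrafilter x" "\<diamond> a \<in> x" by (auto simp: stone_def)
    define I where "I = {b \<in> carrier A. \<diamond> b \<notin> x}"
    have sub: "I \<subseteq> carrier A" by (auto simp: I_def)
    have bot: "\<bottom> \<in> I"
      using closure_dia bottom_notin_ultrafilter [OF x(1)]
      by (auto simp: I_def closure_operator_def)
    have join: "b \<squnion> c \<in> I \<longleftrightarrow> b \<in> I \<and> c \<in> I"
      if "b \<in> carrier A" "c \<in> carrier A" for b c
      using x(1) that by (auto simp: I_def ultrafilter_def dia_join dia_closed)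
    have down: "b \<in> I" if "b \<in> carrier A" "c \<in> I" "b \<sqsubseteq> c" for b c
    proof -
      have "c \<in> carrier A" using that by (simp add: I_def)
      with that show ?thesis using join [of b c] le_iff_meet by metis
    qed
    have "order_ideal I"
      unfolding order_ideal_def
    proof (intro conjI ballI impI)
      fix b c assume "b \<in> I" "c \<in> I"
      then show "b \<squnion> c \<in> I" using join sub by blast
    qed (use sub bot down in auto)
    then obtain z where z: "ultrafilter z" "a \<in> z" "z \<inter> I = {}"
      using ultrafilter_avoiding_ideal [of I a] a x by (auto simp: I_def)
    then have "canonical_rel x z"
      by (auto simp: canonical_rel_def I_def ultrafilter_def)
    with x z show "x \<in> preimage (Collect ultrafilter) canonical_rel (stone a)"
      by (auto simp: preimage_def stone_def)
  qed
qed (auto simp: preimage_def stone_def canonical_rel_def)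

text \<open>Only \<diamond> receives an accessibility relation; \<exists> is transported along the
  bijection \<open>stone\<close>, since depth and colouring concern \<diamond> alone.\<close>

lemma stone_representation:
  "set_representation A (Collect ultrafilter) (stone ` carrier A)
     (preimage (Collect ultrafilter) canonical_rel)
     (\<lambda>U. stone (\<^bold>\<exists> (inv_into (carrier A) stone U))) stone"
proof -
  have inj: "inj_on stone (carrier A)"
    by (rule inj_onI) (metis le_antisym order_refl stone_subset_iff)
  show ?thesis
    unfolding set_representation_def set_representation_axioms_def bij_betw_def
    using inj stone_field
    by (simp add: eq_is_equal stone_subset_iff neg_closed dia_closed ex_closed stone_neg stone_dia)
qed

lemma canonical_general_frame:
  "ms4_general_frame (Collect ultrafilter) (stone ` carrier A) canonical_rel
     (\<lambda>U. stone (\<^bold>\<exists> (inv_into (carrier A) stone U)))"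
proof -
  interpret rep: set_representation A "Collect ultrafilter" "stone ` carrier A"
    "preimage (Collect ultrafilter) canonical_rel"
    "\<lambda>U. stone (\<^bold>\<exists> (inv_into (carrier A) stone U))" stone
    by (rule stone_representation)
  have "ms4_field (Collect ultrafilter) (stone ` carrier A)
     (preimage (Collect ultrafilter) canonical_rel)
     (\<lambda>U. stone (\<^bold>\<exists> (inv_into (carrier A) stone U)))"
    using rep.ms4_algebra_iff ms4_algebra_axioms by simp
  moreover have "canonical_rel x y"
    if "ultrafilter x" "ultrafilter y"
      and *: "\<And>a. a \<in> carrier A \<Longrightarrow> y \<in> stone a \<Longrightarrow>
        x \<in> preimage (Collect ultrafilter) canonical_rel (stone a)" for x y
    unfolding canonical_rel_def
  proof
    fix a assume "a \<in> y"
    then have "a \<in> carrier A" "y \<in> stone a"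
      using that(2) by (auto simp: stone_def ultrafilter_def)
    then have "x \<in> stone (\<diamond> a)"
      using * stone_dia by simp
    then show "\<diamond> a \<in> x" by (simp add: stone_def)
  qed
  ultimately show ?thesis
    by (simp add: ms4_general_frame_def ms4_general_frame_axioms_def)
qed

end


section \<open>Depth\<close>

text \<open>Depth counted in clusters: strictly ascending \<open>R\<close>-chains from such a point
  have at most \<open>m\<close> members. Level 1 consists of the maximal clusters.\<close>

primrec depth_le :: "'x set \<Rightarrow> ('x \<Rightarrow> 'x \<Rightarrow> bool) \<Rightarrow> nat \<Rightarrow> 'x set" where
  "depth_le X R 0 = {}"
| "depth_le X R (Suc m) = {x \<in> X. \<forall>y\<in>X. R x y \<longrightarrow> R y x \<or> y \<in> depth_le X R m}"

lemma depth_le_subset: "depth_le X R m \<subseteq> X"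
  by (cases m) auto

lemma depth_le_mono_Suc: "depth_le X R m \<subseteq> depth_le X R (Suc m)"
  by (induction m) auto

text \<open>The dummy \<open>P 0 = Bot\<close> turns \<open>P 1\<close> into an instance of the
  general recursion, so inductions can start at 0.\<close>

lemma sval_P_Suc:
  "sval X D E v (P (Suc m)) =
     (X - D ((X - D (X - v (Suc m))) \<inter> (X - sval X D E v (P m)))) \<union> (X - D (X - v (Suc m)))"
proof (cases m)
  case 0
  have "(X - D (X - v (Suc 0))) \<inter> X = X - D (X - v (Suc 0))" by blast
  with 0 show ?thesis by (simp add: Imp_def Box_def)
qed (simp add: Imp_def Box_def)

text \<open>\<open>P m\<close> contains only letters up to \<open>m\<close> and no
  \<open>Ex\<close>. So the next letter can be reassigned freely, and \<open>E\<close> can be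
  exchanged for another operator.\<close>

lemma sval_P_cong:
  assumes "\<And>i. i \<le> m \<Longrightarrow> v i = w i"
  shows "sval X D E v (P m) = sval X D E' w (P m)"
  using assms by (induction m) (simp_all add: sval_P_Suc)

context ms4_general_frame
begin

text \<open>Either \<open>y\<close> is strictly above \<open>x\<close> and lies one level lower, or
  it shares the cluster of \<open>x\<close> and by transitivity sees the same points.\<close>

lemma depth_le_upward:
  assumes "x \<in> depth_le X R m" "y \<in> X" "R x y"
  shows "y \<in> depth_le X R m"
proof (cases m)
  case (Suc k)
  have "y \<in> depth_le X R (Suc k)" if "R y x"
  proof -
    have "R z y \<or> z \<in> depth_le X R k" if "z \<in> X" "R y z" for z
    proof -
      have "R x z" using R_trans [of x y z] assms that depth_le_subset [of X R m] by blast
      then have "R z x \<or> z \<in> depth_le X R k"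
        using assms that Suc by auto
      then show ?thesis
        using R_trans [of z x y] assms that depth_le_subset [of X R m] by blast
    qed
    then show ?thesis using assms by auto
  qed
  moreover have "R y x \<or> y \<in> depth_le X R k"
    using assms Suc by auto
  ultimately show ?thesis
    using Suc depth_le_mono_Suc [of X R k] by (metis subsetD)
qed (use assms in simp)

lemma P_fails_above_depth:
  assumes "x \<in> X" "x \<notin> depth_le X R m"
  shows "\<exists>v\<in>UNIV \<rightarrow> F. x \<notin> sval X (preimage X R) E v (P m)"
  using assms
proof (induction m arbitrary: x)
  case 0
  then show ?case
    using empty_closed by (auto intro!: bexI [of _ "\<lambda>_. {}"])
next
  case (Suc m)
  let ?D = "preimage X R"
  from Suc.prems obtain y where y: "y \<in> X" "R x y" "\<not> R y x" "y \<notin> depth_le X R m"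
    by auto
  then obtain v where v: "v \<in> UNIV \<rightarrow> F" "y \<notin> sval X ?D E v (P m)"
    using Suc.IH by blast
  \<comment> \<open>Tightness applied to the missing arrow from \<open>y\<close> back to
    \<open>x\<close> separates the two points.\<close>
  obtain U where U: "U \<in> F" "x \<in> U" "y \<notin> ?D U"
    using tight [of y x] y Suc.prems by blast
  \<comment> \<open>The letter \<open>Suc m\<close> is fresh for \<open>P m\<close>. With this value
    its box is the complement of \<open>?D U\<close>, hence true at \<open>y\<close> and false at
    \<open>x\<close>; so \<open>x\<close> sees a point satisfying the box and refuting
    \<open>P m\<close>.\<close>
  define w where "w = v(Suc m := X - U)"
  have w: "w \<in> UNIV \<rightarrow> F"
    using v U by (auto simp: w_def compl_closed)
  have "y \<notin> sval X ?D E w (P m)"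
    using v sval_P_cong [of m v w X ?D E E] by (auto simp: w_def)
  moreover have "X - w (Suc m) = U"
    using U subset_X by (auto simp: w_def)
  moreover have "x \<in> ?D U"
    using U closure_D by (auto simp: set_closure_def)
  ultimately have "x \<notin> sval X ?D E w (P (Suc m))"
    using y U Suc.prems(1) unfolding sval_P_Suc by (auto simp: preimage_def)
  with w show ?case by blast
qed

end


section \<open>Finite bisimulation quotients\<close>

text \<open>Recoding colours as numbers keeps one colour type throughout the induction on
  depth.\<close>

lemma finite_range_nat_coding:
  fixes f :: "'x \<Rightarrow> 'b"
  assumes "finite (f ` A)"
  obtains c :: "'x \<Rightarrow> nat" where "\<And>x y. x \<in> A \<Longrightarrow> y \<in> A \<Longrightarrow> c x = c y \<longleftrightarrow> f x = f y"
proof -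
  obtain e :: "'b \<Rightarrow> nat" where "inj_on e (f ` A)"
    using finite_imp_inj_to_nat_seg [OF assms] by blast
  then show ?thesis
    by (intro that [of "e \<circ> f"]) (auto simp: inj_on_def)
qed

text \<open>Having equal colours is a bisimulation refining \<open>g\<close>, with finitely many
  classes. Each further level of depth adds only finitely many kinds of points.\<close>

lemma (in ms4_general_frame) finite_bisimulation_colouring:
  fixes g :: "'x \<Rightarrow> 'b"
  assumes g: "finite (g ` X)"
  shows "\<exists>c :: 'x \<Rightarrow> nat. finite (c ` depth_le X R m) \<and>
    (\<forall>x\<in>depth_le X R m. \<forall>y\<in>depth_le X R m. c x = c y \<longrightarrow>
       g x = g y \<and> (\<forall>x'\<in>X. R x x' \<longrightarrow> (\<exists>y'\<in>X. R y y' \<and> c x' = c y')))"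
proof (induction m)
  case (Suc m)
  let ?L = "depth_le X R m" and ?M = "depth_le X R (Suc m)"
  from Suc obtain c :: "'x \<Rightarrow> nat" where fin: "finite (c ` ?L)"
    and c_g: "\<And>x y. x \<in> ?L \<Longrightarrow> y \<in> ?L \<Longrightarrow> c x = c y \<Longrightarrow> g x = g y"
    and c_R: "\<And>x y x'. x \<in> ?L \<Longrightarrow> y \<in> ?L \<Longrightarrow> c x = c y \<Longrightarrow> x' \<in> X \<Longrightarrow> R x x' \<Longrightarrow>
      \<exists>y'\<in>X. R y y' \<and> c x' = c y'"
    by blast
  text \<open>A point of depth exactly \<open>Suc m\<close> is determined by its \<open>g\<close>-value, the colours it sees
    strictly above its cluster, and the \<open>g\<close>-values in its cluster.\<close>
  define f where "f x = (if x \<in> ?L then Inl (c x)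
      else Inr (g x, c ` {y \<in> ?L. R x y}, g ` {y \<in> X. R x y \<and> y \<notin> ?L}))" for x
  have "f ` X \<subseteq> Inl ` c ` ?L \<union> Inr ` (g ` X \<times> Pow (c ` ?L) \<times> Pow (g ` X))"
    by (auto simp: f_def)
  then have fin_f: "finite (f ` X)"
    by (rule finite_subset) (use fin g in auto)
  have f_g: "g x = g y" if "x \<in> ?M" "y \<in> ?M" "f x = f y" for x y
    using that(3) c_g [of x y] by (simp add: f_def split: if_splits)
  have f_R: "\<exists>y'\<in>X. R y y' \<and> f x' = f y'"
    if x: "x \<in> ?M" and y: "y \<in> ?M" and eq: "f x = f y" and x': "x' \<in> X" "R x x'" for x y x'
  proof (cases "x \<in> ?L")
    case True
    then have "y \<in> ?L" "c x = c y"
      using eq by (auto simp: f_def split: if_splits)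
    then obtain y' where "y' \<in> X" "R y y'" "c x' = c y'"
      using c_R True x' by blast
    moreover have "x' \<in> ?L" "y' \<in> ?L"
      using depth_le_upward True \<open>y \<in> ?L\<close> x' calculation by blast+
    ultimately show ?thesis by (auto simp: f_def)
  next
    case False
    then have "y \<notin> ?L"
      and c_eq: "c ` {z \<in> ?L. R x z} = c ` {z \<in> ?L. R y z}"
      and g_eq: "g ` {z \<in> X. R x z \<and> z \<notin> ?L} = g ` {z \<in> X. R y z \<and> z \<notin> ?L}"
      using eq by (auto simp: f_def split: if_splits)
    show ?thesis
    proof (cases "x' \<in> ?L")
      case True
      then have "c x' \<in> c ` {z \<in> ?L. R y z}"
        using x' c_eq by blast
      then obtain y' where "y' \<in> ?L" "R y y'" "c x' = c y'" by blast
      with True show ?thesis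
        using depth_le_subset [of X R m] unfolding f_def by auto
    next
      case x'_L: False
      then have "g x' \<in> g ` {z \<in> X. R y z \<and> z \<notin> ?L}"
        using x' g_eq by blast
      then obtain y' where y': "y' \<in> X" "R y y'" "y' \<notin> ?L" "g x' = g y'" by blast
      \<comment> \<open>A successor of \<open>u\<close> outside \<open>?L\<close> also sees
        \<open>u\<close>, hence shares its cluster and successors. Thus \<open>x'\<close> and
        \<open>y'\<close> inherit the matching data of \<open>x\<close> and \<open>y\<close>, and
        \<open>y'\<close> was picked to agree in the \<open>g\<close>-value.\<close>
      have cluster: "{z \<in> X. R u' z} = {z \<in> X. R u z}"
        if "u \<in> ?M" "u' \<in> X" "R u u'" "u' \<notin> ?L" for u u'
      proof -
        have "u \<in> X" "R u' u" using that by auto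
        then show ?thesis using that R_trans by blast
      qed
      have cl: "{z \<in> X. R x' z} = {z \<in> X. R x z}" "{z \<in> X. R y' z} = {z \<in> X. R y z}"
        using cluster x x' x'_L y y' by blast+
      have L: "{z \<in> ?L. R u z} = {z \<in> X. R u z} \<inter> ?L"
        and M: "{z \<in> X. R u z \<and> z \<notin> ?L} = {z \<in> X. R u z} - ?L" for u
        using depth_le_subset [of X R m] by auto
      have "f x' = f y'"
        using x'_L y' c_eq g_eq unfolding f_def L M cl by simp
      with y' show ?thesis by blast
    qed
  qed
  obtain d :: "'x \<Rightarrow> nat" where d: "\<And>x y. x \<in> X \<Longrightarrow> y \<in> X \<Longrightarrow> d x = d y \<longleftrightarrow> f x = f y"
    using finite_range_nat_coding [OF fin_f] by blast
  have M_X: "?M \<subseteq> X" by auto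
  have "finite (d ` X)"
  proof -
    \<comment> \<open>\<open>d\<close> factors through \<open>f\<close>, so its range is finite
      too.\<close>
    have "d ` X = (\<lambda>a. d (inv_into X f a)) ` f ` X"
      unfolding image_image
      by (rule image_cong) (auto simp: d inv_into_into f_inv_into_f)
    with fin_f show ?thesis by simp
  qed
  then have "finite (d ` ?M)"
    using M_X by (meson finite_subset image_mono)
  moreover have "g x = g y \<and> (\<forall>x'\<in>X. R x x' \<longrightarrow> (\<exists>y'\<in>X. R y y' \<and> d x' = d y'))"
    if "x \<in> ?M" "y \<in> ?M" "d x = d y" for x y
  proof -
    have "f x = f y" using d that M_X by blast
    with that f_g f_R d show ?thesis by metis
  qed
  ultimately show ?case by blast
qed simp

text \<open>By the bisimulation property the preimage of a union of colour classes is again one, and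
  finitely many colours leave only finitely many such unions.\<close>

lemma (in ms4_general_frame) finite_dia_subalgebra:
  assumes X: "depth_le X R n = X" and G: "finite G" "G \<subseteq> F"
  obtains S where "finite S" "G \<subseteq> S" "S \<subseteq> F" "field_of_sets X S" "preimage X R \<in> S \<rightarrow> S"
proof -
  \<comment> \<open>Colours refine membership in the sets of \<open>G\<close>, so each of these is a
    union of classes.\<close>
  define g where "g x = {U \<in> G. x \<in> U}" for x
  have "finite (g ` X)"
    by (rule finite_subset [of _ "Pow G"]) (auto simp: g_def G)
  then obtain c :: "'x \<Rightarrow> nat" where fin: "finite (c ` X)"
    and c_g: "\<And>x y. x \<in> X \<Longrightarrow> y \<in> X \<Longrightarrow> c x = c y \<Longrightarrow> g x = g y"
    and c_R: "\<And>x y x'. x \<in> X \<Longrightarrow> y \<in> X \<Longrightarrow> c x = c y \<Longrightarrow> x' \<in> X \<Longrightarrow> R x x' \<Longrightarrow>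
      \<exists>y'\<in>X. R y y' \<and> c x' = c y'"
    using finite_bisimulation_colouring [of g n] unfolding X by metis
  \<comment> \<open>Only unions of classes that lie in \<open>F\<close> are kept; a single class
    need not lie in \<open>F\<close>.\<close>
  define S where "S = {U \<in> F. \<forall>x\<in>X. \<forall>y\<in>X. c x = c y \<longrightarrow> x \<in> U \<longrightarrow> y \<in> U}"
  have S_F: "U \<in> F" if "U \<in> S" for U
    using that unfolding S_def by blast
  have S_sat: "y \<in> U" if "U \<in> S" "x \<in> X" "y \<in> X" "c x = c y" "x \<in> U" for U x y
    using that unfolding S_def by blast
  have S_I: "U \<in> S"
    if "U \<in> F" "\<And>x y. x \<in> X \<Longrightarrow> y \<in> X \<Longrightarrow> c x = c y \<Longrightarrow> x \<in> U \<Longrightarrow> y \<in> U" for U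
    using that unfolding S_def by blast
  have S_X: "x \<in> X" if "U \<in> S" "x \<in> U" for U x
    using S_F subset_X that by blast
  have "finite S"
  proof (rule finite_imageD)
    show "finite ((`) c ` S)"
      by (rule finite_subset [of _ "Pow (c ` X)"]) (use fin S_X in auto)
    have "U \<subseteq> V" if "U \<in> S" "V \<in> S" "c ` U = c ` V" for U V
    proof
      fix x assume x: "x \<in> U"
      then obtain y where "y \<in> V" "c y = c x"
        using \<open>c ` U = c ` V\<close> by (metis imageE imageI)
      then show "x \<in> V"
        using S_sat S_X that x by blast
    qed
    then show "inj_on ((`) c) S"
      by (intro inj_onI equalityI) auto
  qed
  moreover have "G \<subseteq> S"
  proof
    fix U assume U: "U \<in> G"
    show "U \<in> S"
    proof (rule S_I)
      fix x y assume "x \<in> X" "y \<in> X" "c x = c y" "x \<in> U"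
      then have "U \<in> g x" "g x = g y"
        using U c_g unfolding g_def by blast+
      then have "U \<in> g y" by simp
      then show "y \<in> U" by (simp add: g_def)
    qed (use U G in auto)
  qed
  moreover have "field_of_sets X S"
  proof
    fix U V assume U: "U \<in> S" and V: "V \<in> S"
    show "U \<union> V \<in> S"
      using S_F [OF U] S_F [OF V] S_sat [OF U] S_sat [OF V] by (intro S_I Un_closed) blast+
  next
    fix U assume U: "U \<in> S"
    show "X - U \<in> S"
    proof (rule S_I)
      fix x y assume "x \<in> X" "y \<in> X" "c x = c y" "x \<in> X - U"
      then show "y \<in> X - U" using S_sat [OF U, of y x] by auto
    qed (use S_F [OF U] compl_closed in auto)
    show "U \<subseteq> X" using S_F [OF U] subset_X by blast
  qed (auto intro: S_I empty_closed)
  moreover have "preimage X R U \<in> S" if U: "U \<in> S" for U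
  proof (rule S_I)
    fix x y assume xy: "x \<in> X" "y \<in> X" "c x = c y" "x \<in> preimage X R U"
    then obtain x' where x': "x' \<in> U" "R x x'"
      by (auto simp: preimage_def)
    have "x' \<in> X" using x' U S_X by blast
    then obtain y' where y': "y' \<in> X" "R y y'" "c x' = c y'"
      using c_R x' xy by blast
    have "y' \<in> U"
      using S_sat [OF U] x' \<open>x' \<in> X\<close> y' by blast
    then show "y \<in> preimage X R U"
      using xy y' by (auto simp: preimage_def)
  next
    show "preimage X R U \<in> F"
      using S_F [OF U] closure_D by (auto simp: set_closure_def)
  qed
  ultimately show ?thesis
    using S_F by (intro that [of S]) auto
qed


section \<open>Restricting the monadic operator to a finite subalgebra\<close>

definition coarse_ex :: "'x set set \<Rightarrow> ('x set \<Rightarrow> 'x set) \<Rightarrow> 'x set \<Rightarrow> 'x set" where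
  "coarse_ex S E U = \<Inter>{V \<in> S. U \<subseteq> V \<and> E V = V}"

context ms4_field
begin

text \<open>\<open>E U\<close> is itself in the family being intersected, and by monotonicity it is
  below every other member.\<close>

lemma coarse_ex_eq:
  assumes "S \<subseteq> F" "U \<in> S" "E U \<in> S"
  shows "coarse_ex S E U = E U"
proof
  have "U \<in> F" "E U \<in> F" using assms by auto
  then have "E (E U) = E U" "U \<subseteq> E U"
    using closure_E by (simp_all add: set_closure_def subset_antisym)
  then show "coarse_ex S E U \<subseteq> E U"
    using assms by (auto simp: coarse_ex_def)
  have "E U \<subseteq> V" if "V \<in> S" "U \<subseteq> V" "E V = V" for V
    using set_closure_mono [OF closure_E, of U V] that assms by auto
  then show "E U \<subseteq> coarse_ex S E U"
    by (auto simp: coarse_ex_def)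
qed

text \<open>The \<open>E\<close>-fixed members of \<open>S\<close> form a finite field of sets
  closed under \<open>D\<close>. Unions give additivity, complements the S5 law, and closure under
  \<open>D\<close> the law linking the two operators.\<close>

lemma ms4_field_coarse_ex:
  assumes fin: "finite S" and S: "S \<subseteq> F" "field_of_sets X S" and D: "D \<in> S \<rightarrow> S"
  shows "ms4_field X S D (coarse_ex S E)"
proof -
  interpret S: field_of_sets X S by (rule S)
  let ?E = "coarse_ex S E"
  let ?Fix = "{V \<in> S. E V = V}"
  have E_mono: "E U \<subseteq> E V" if "U \<in> S" "V \<in> S" "U \<subseteq> V" for U V
    using set_closure_mono [OF closure_E] that S by blast
  have E_ge: "U \<subseteq> E U" if "U \<in> S" for U
    using closure_E that S by (auto simp: set_closure_def)
  have fix_X: "X \<in> ?Fix"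
    using S.space_closed E_ge [of X] closure_E S subset_X
    by (auto simp: set_closure_def)
  have fix_empty: "{} \<in> ?Fix"
    using S.empty_closed closure_E by (simp add: set_closure_def)
  have fix_Int: "U \<inter> V \<in> ?Fix" if "U \<in> ?Fix" "V \<in> ?Fix" for U V
    using that S.Int_closed E_mono [of "U \<inter> V" U] E_mono [of "U \<inter> V" V] E_ge [of "U \<inter> V"]
    by auto
  have fix_Un: "U \<union> V \<in> ?Fix" if "U \<in> ?Fix" "V \<in> ?Fix" for U V
    using that S S.Un_closed closure_E by (auto simp: set_closure_def subset_iff)
  have fix_compl: "X - U \<in> ?Fix" if "U \<in> ?Fix" for U
    using that S.compl_closed [of U] E_compl [of U] S(1) E_ge [of "X - U"] by auto
  \<comment> \<open>An empty intersection would be the whole type; the family defining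
    \<open>coarse_ex\<close> always contains \<open>X\<close>.\<close>
  have fix_Inter: "\<Inter>\<V> \<in> ?Fix" if "finite \<V>" "\<V> \<noteq> {}" "\<V> \<subseteq> ?Fix" for \<V>
    using that
  proof (induction rule: finite_ne_induct)
    case (insert V \<V>)
    then have "V \<inter> \<Inter>\<V> \<in> ?Fix" by (intro fix_Int) auto
    then show ?case by simp
  qed auto
  have E_fix: "?E U \<in> ?Fix" if "U \<in> S" for U
    unfolding coarse_ex_def
    by (rule fix_Inter) (use fin that fix_X S.subset_X in auto)
  have le_E: "U \<subseteq> ?E U" for U
    by (auto simp: coarse_ex_def)
  have E_le: "?E U \<subseteq> V" if "U \<subseteq> V" "V \<in> ?Fix" for U V
    using that by (auto simp: coarse_ex_def)
  have closure: "set_closure S ?E"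
    unfolding set_closure_def
  proof (intro conjI ballI)
    fix U V assume UV: "U \<in> S" "V \<in> S"
    show "?E (U \<union> V) = ?E U \<union> ?E V"
    proof
      show "?E (U \<union> V) \<subseteq> ?E U \<union> ?E V"
        by (rule E_le [OF Un_mono [OF le_E le_E] fix_Un [OF E_fix E_fix]]) (use UV in auto)
      show "?E U \<union> ?E V \<subseteq> ?E (U \<union> V)"
        by (auto simp: coarse_ex_def)
    qed
  next
    show "?E \<in> S \<rightarrow> S" using E_fix by auto
    show "?E {} = {}" using E_le [of "{}" "{}"] fix_empty by blast
    fix U assume "U \<in> S"
    then show "?E (?E U) \<subseteq> ?E U"
      using E_le E_fix by blast
    show "U \<subseteq> ?E U" by (rule le_E)
  qed
  have "set_closure S D"
    using D closure_D S(1) unfolding set_closure_def by (simp add: subset_iff)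
  moreover have "?E (X - ?E U) \<subseteq> X - ?E U" if "U \<in> S" for U
    by (rule E_le [OF order_refl fix_compl [OF E_fix [OF that]]])
  moreover have "?E (D U) \<subseteq> D (?E U)" if U: "U \<in> S" for U
  proof (rule E_le)
    let ?V = "?E U"
    have V: "?V \<in> S" "E ?V = ?V" using E_fix [OF U] by auto
    show "D U \<subseteq> D ?V"
      using set_closure_mono [OF closure_D] U V(1) S(1) le_E by blast
    \<comment> \<open>As \<open>?V\<close> is fixed,
      \<open>E (D ?V) \<subseteq> D (E ?V) = D ?V\<close>, so \<open>D ?V\<close> is fixed as
      well.\<close>
    have "E (D ?V) \<subseteq> D ?V"
      using E_D [of ?V] V S(1) by auto
    moreover have "D ?V \<in> S" using D V by auto
    ultimately show "D ?V \<in> ?Fix"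
      using E_ge by auto
  qed
  ultimately show ?thesis
    using closure S(2) by (simp add: ms4_field_def ms4_field_axioms_def)
qed

end

section \<open>Transfer of the refutation to a finite algebra\<close>

primrec subformulas :: "fm \<Rightarrow> fm set" where
  "subformulas (Var i) = {Var i}"
| "subformulas Bot = {Bot}"
| "subformulas (Neg \<phi>) = insert (Neg \<phi>) (subformulas \<phi>)"
| "subformulas (Conj \<phi> \<psi>) = insert (Conj \<phi> \<psi>) (subformulas \<phi> \<union> subformulas \<psi>)"
| "subformulas (Disj \<phi> \<psi>) = insert (Disj \<phi> \<psi>) (subformulas \<phi> \<union> subformulas \<psi>)"
| "subformulas (Dia \<phi>) = insert (Dia \<phi>) (subformulas \<phi>)"
| "subformulas (Ex \<phi>) = insert (Ex \<phi>) (subformulas \<phi>)"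

lemma finite_subformulas: "finite (subformulas \<phi>)"
  by (induction \<phi>) auto

lemma subformulas_refl: "\<phi> \<in> subformulas \<phi>"
  by (cases \<phi>) auto

text \<open>At every \<open>Ex\<close> inside the formula both the argument and its image under
  \<open>E\<close> lie in \<open>S\<close>, which is exactly where \<open>E'\<close> agrees with
  \<open>E\<close>.\<close>

lemma sval_subalgebra_cong:
  assumes "sval X D E v ` subformulas \<phi> \<subseteq> S"
    and "\<And>i. v i \<in> S \<Longrightarrow> w i = v i"
    and "\<And>U. U \<in> S \<Longrightarrow> E U \<in> S \<Longrightarrow> E' U = E U"
  shows "sval X D E' w \<phi> = sval X D E v \<phi>"
  using assms(1)
proof (induction \<phi>)
  case (Ex \<phi>)
  moreover have "sval X D E v \<phi> \<in> S"
    using Ex.prems subformulas_refl [of \<phi>] by auto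
  ultimately show ?case
    using assms(3) by simp
qed (use assms(2) in \<open>simp_all add: image_Un\<close>)

text \<open>Recoding the members of \<open>F\<close> by the numbers below \<open>card F\<close>
  places the algebra in the type \<open>nat\<close>, whatever the type of points.\<close>

lemma (in ms4_field) finite_nat_representation:
  assumes "finite F"
  obtains A :: "nat ms4" and h where "finite (carrier A)" "set_representation A X F D E h"
proof -
  obtain h where h: "bij_betw h {0..<card F} F"
    using ex_bij_betw_nat_finite [OF assms] by blast
  define k where "k = inv_into {0..<card F} h"
  define A :: "nat ms4" where "A = \<lparr>carrier = {0..<card F}, eq = (=), le = (\<lambda>a b. h a \<subseteq> h b),
    neg = (\<lambda>a. k (X - h a)), dia = (\<lambda>a. k (D (h a))), ex = (\<lambda>a. k (E (h a)))\<rparr>"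
  have hF: "h a \<in> F" if "a < card F" for a
    using h that by (auto simp: bij_betw_def)
  have k: "k U < card F \<and> h (k U) = U" if "U \<in> F" for U
  proof -
    have "U \<in> h ` {0..<card F}" using h that by (auto simp: bij_betw_def)
    then show ?thesis
      using inv_into_into [of U h "{0..<card F}"] f_inv_into_f [of U h "{0..<card F}"]
      by (simp add: k_def)
  qed
  have "D \<in> F \<rightarrow> F" "E \<in> F \<rightarrow> F"
    using closure_D closure_E by (auto simp: set_closure_def)
  then have "set_representation A X F D E h"
    by unfold_locales (use h in \<open>auto simp: A_def hF k compl_closed Pi_iff\<close>)
  moreover have "finite (carrier A)" by (simp add: A_def)
  ultimately show ?thesis using that by blast
qed

theorem theorem3p3:
  fixes n :: nat and \<phi> :: fm
  assumes "n \<ge> 1"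
    and "\<not> class_valid (MS4 n :: 'a ms4 set) \<phi>"
  shows "\<exists>\<AA> :: nat ms4. \<AA> \<in> MS4 n \<and> finite (carrier \<AA>) \<and> \<not> valid \<AA> \<phi>"
proof -
  obtain A :: "'a ms4" where "ms4_algebra A" and P_n: "valid A (P n)" and "\<not> valid A \<phi>"
    using assms(2) by (auto simp: class_valid_def MS4_def)
  interpret A: ms4_algebra A by fact
  define X where "X = Collect A.ultrafilter"
  define F where "F = A.stone ` carrier A"
  define R where "R = A.canonical_rel"
  define D where "D = preimage X R"
  define E where "E U = A.stone (ex A (inv_into (carrier A) A.stone U))" for U
  interpret rep: set_representation A X F D E A.stone
    using A.stone_representation unfolding X_def F_def D_def R_def E_def .
  interpret frame: ms4_general_frame X F R E
    using A.canonical_general_frame unfolding X_def F_def R_def E_def .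
  \<comment> \<open>A point of larger depth would refute \<open>P n\<close> under some valuation in
    \<open>F\<close>.\<close>
  have depth: "depth_le X R n = X"
  proof (rule ccontr)
    assume "depth_le X R n \<noteq> X"
    then obtain x where "x \<in> X" "x \<notin> depth_le X R n"
      using depth_le_subset [of X R n] by blast
    then obtain v where "v \<in> UNIV \<rightarrow> F" "x \<notin> sval X D E v (P n)"
      using frame.P_fails_above_depth unfolding D_def by blast
    then show False
      using P_n \<open>x \<in> X\<close> unfolding rep.valid_iff by blast
  qed
  obtain v where v: "v \<in> UNIV \<rightarrow> F" "sval X D E v \<phi> \<noteq> X"
    using \<open>\<not> valid A \<phi>\<close> unfolding rep.valid_iff by blast
  have closed: "D \<in> F \<rightarrow> F" "E \<in> F \<rightarrow> F"
    using frame.closure_D frame.closure_E by (auto simp: set_closure_def D_def)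
  have "sval X D E v ` subformulas \<phi> \<subseteq> F"
    using rep.sval_closed [OF closed] v by blast
  then obtain S where S: "finite S" "sval X D E v ` subformulas \<phi> \<subseteq> S" "S \<subseteq> F"
      "field_of_sets X S" "D \<in> S \<rightarrow> S"
    using frame.finite_dia_subalgebra [OF depth finite_imageI [OF finite_subformulas]]
    unfolding D_def by metis
  define E' where "E' = coarse_ex S E"
  interpret S: ms4_field X S D E'
    using frame.ms4_field_coarse_ex S unfolding D_def E'_def by blast
  obtain B :: "nat ms4" and h where B: "finite (carrier B)" "set_representation B X S D E' h"
    using S.finite_nat_representation [OF S(1)] by blast
  interpret B: set_representation B X S D E' h by (rule B)
  have "ms4_algebra B"
    using B.ms4_algebra_iff S.ms4_field_axioms by simp
  \<comment> \<open>A valuation in \<open>S\<close> is one in \<open>F\<close>, and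
    \<open>P n\<close> has the same value for \<open>E'\<close> as for \<open>E\<close>.\<close>
  moreover have "sval X D E' w (P n) = X" if "w \<in> UNIV \<rightarrow> S" for w
  proof -
    have "w \<in> UNIV \<rightarrow> F" using that S(3) by auto
    then have "sval X D E w (P n) = X" using P_n unfolding rep.valid_iff by blast
    then show ?thesis using sval_P_cong [of n w w X D E E'] by simp
  qed
  then have "valid B (P n)" unfolding B.valid_iff by blast
  moreover have "\<not> valid B \<phi>"
  proof -
    \<comment> \<open>\<open>v\<close> is known to take values in \<open>S\<close> only at letters
      of \<phi>; any value outside \<open>S\<close> is replaced by \<open>{}\<close>, which every
      field of sets contains.\<close>
    define w where "w i = (if v i \<in> S then v i else {})" for i
    have "sval X D E' w \<phi> = sval X D E v \<phi>"
      by (rule sval_subalgebra_cong [OF S(2)])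
        (simp_all add: w_def E'_def frame.coarse_ex_eq [OF S(3)])
    moreover have "w \<in> UNIV \<rightarrow> S"
      using S.empty_closed by (auto simp: w_def)
    ultimately show ?thesis
      using v unfolding B.valid_iff by metis
  qed
  ultimately show ?thesis
    using B(1) by (auto simp: MS4_def)
qed

end
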